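(* Let $\Omega$, $a$, $n_1,n_2,n_3$, ${\bf e}$, $\sigma_1$, $\rho$, $P$, $\nu$, ${\bf m}$, $d$, $Q$, $\sigma_2$ be as in the setting described in the context, with ${\bf e}=(e',e_3)$ a $C^1$ unit field on $\Omega$. If there exists a $C^1$ phase discontinuity $\phi$ on a neighborhood of $\sigma_2$ such that the lens $(\sigma_1,(\sigma_2,\phi))$ refracts the field ${\bf e}(x)$, $x\in\Omega$, into ${\bf w}=(0,0,1)$, then $e'=\nabla h$ on $\Omega$ for some $C^2$ function $h:\Omega\to\mathbb R$, and so $$\nabla\times e'(x)=0\qquad\text{for every } x\in\Omega .$$
   Context: Vectors are row vectors. For a planar $C^1$ field ${\bf b}=(b_1,b_2)$ of $x=(x_1,x_2)$, $\nabla\times{\bf b}=(b_2)_{x_1}-(b_1)_{x_2}$. Setting. $\Omega\subseteq\mathbb R^2$ is open and connected; $a>0$; $n_1,n_2,n_3>0$ are refractive indices of media I, II, III with $n_2>n_1$; $\kappa_1=n_2/n_1>1$, $\kappa_2=n_3/n_2$; $k>0$ is the wave number in medium II. ${\bf e}(x)=(e_1(x),e_2(x),e_3(x))=(e'(x),e_3(x))$ is a unit vector field on $\Omega$ with $e'=(e_1,e_2)$ and $e_3>0$. $\sigma_1$ is a $C^2$ surface contained in $\{0<x_3<a\}$, separating medium I (below) from medium II (between $\sigma_1$ and the plane $\{x_3=a\}$); medium III is above $\{x_3=a\}$. The ray issued from $(x,0)$, $x\in\Omega$, with direction ${\bf e}(x)$ strikes $\sigma_1$ at $P(x)=(x,0)+\rho(x){\bf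 e}(x)$, where $\rho(x)=|P(x)-(x,0)|>0$, and $\rho$ is a $C^1$ function on $\Omega$. $\nu=\nu(x)$ denotes the unit normal to $\sigma_1$ at $P(x)$ toward medium II; it is assumed that ${\bf e}(x)\cdot\nu\ge 0$ and $\nu_3>0$. The refracted unit direction in medium II is, by Snell's law, $${\bf m}(x)=\frac1{\kappa_1}\left({\bf e}(x)-\lambda\nu\right)=(m_1(x),m_2(x),m_3(x)),\qquad \lambda={\bf e}(x)\cdot\nu-\sqrt{\kappa_1^2-1+({\bf e}(x)\cdot\nu)^2},$$ so that $m_3>0$. This ray meets the plane $\{x_3=a\}$ at $(Q(x),a)=P(x)+d(x){\bf m}(x)$, where $Q(x)=(Q_1(x),Q_2(x))$ and $d(x)=\dfrac{a-\rho(x)e_3(x)}{m_3(x)}$. Put $\sigma_2=\{(Q(x),a):x\in\Omega\}$. Metasurface. A phase discontinuity is a $C^1$ real function $\phi(u_1,u_2,u_3)$ defined on an open neighborhood of $\sigma_2$ in $\mathbb R^3$. The lens $(\sigma_1,(\sigma_2,\phi))$ has lower face the refracting surface $\sigma_1$ and upper face the flat metasurface $(\sigma_2,\phi)$. It refracts the field ${\bf e}$ into ${\bf w}=(0,0,1)$ if for every $x\in\Omega$ the generalized Snell law holds at $(Q(x),a)$ with incident direction ${\bf m}(x)$, normal $(0,0,1)$ and refracted direction ${\bf w}$: $${\bf m}(x)-\tfrac1k\nabla\phi(Q(x),a)-\kappa_2{\bf w}=\mu\,(0,0,1),$$ where, with ${\bf q}={\bf m}(x)-\frac1k\nabla\phi(Q(x),a)$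 and $q_3$ its third component, $\mu=q_3-\sqrt{\kappa_2^2-|{\bf q}|^2+q_3^2}$, and the quantity under the square root is required to be nonnegative. *)

theory Defs
  imports "HOL-Analysis.Analysis"
begin

text \<open>For functions on an open set; the values of the derivative outside \<open>S\<close> are irrelevant.\<close>

definition C1_on :: "('a::real_normed_vector \<Rightarrow> 'b::real_normed_vector) \<Rightarrow> 'a set \<Rightarrow> bool" where
  "C1_on f S \<longleftrightarrow>
     (\<exists>f' :: 'a \<Rightarrow> 'a \<Rightarrow>\<^sub>L 'b.
        (\<forall>x\<in>S. (f has_derivative blinfun_apply (f' x)) (at x)) \<and> continuous_on S f')"

definition C2_on :: "('a::real_normed_vector \<Rightarrow> 'b::real_normed_vector) \<Rightarrow> 'a set \<Rightarrow> bool" where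
  "C2_on f S \<longleftrightarrow>
     (\<exists>f' :: 'a \<Rightarrow> 'a \<Rightarrow>\<^sub>L 'b.
        (\<forall>x\<in>S. (f has_derivative blinfun_apply (f' x)) (at x)) \<and> C1_on f' S)"

definition partial_deriv :: "(real^'n \<Rightarrow> real) \<Rightarrow> 'n \<Rightarrow> real^'n \<Rightarrow> real" where
  "partial_deriv f i x = deriv (\<lambda>t. f (x + t *\<^sub>R axis i 1)) 0"

definition grad :: "(real^'n \<Rightarrow> real) \<Rightarrow> real^'n \<Rightarrow> real^'n" where
  "grad f x = (\<chi> i. partial_deriv f i x)"

definition curl2 :: "(real^2 \<Rightarrow> real^2) \<Rightarrow> real^2 \<Rightarrow> real" where
  "curl2 b x = partial_deriv (\<lambda>y. b y $ 2) 1 x - partial_deriv (\<lambda>y. b y $ 1) 2 x"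

definition horiz :: "real^3 \<Rightarrow> real^2" where
  "horiz v = vector [v $ 1, v $ 2]"

definition at_height :: "real^2 \<Rightarrow> real \<Rightarrow> real^3" where
  "at_height x t = vector [x $ 1, x $ 2, t]"

definition e3 :: "real^3" where
  "e3 = vector [0, 0, 1]"

text \<open>Embedded surfaces without boundary: locally regular level sets.\<close>

definition C2_surface :: "(real^3) set \<Rightarrow> bool" where
  "C2_surface S \<longleftrightarrow>
     (\<forall>p\<in>S. \<exists>U F. open U \<and> p \<in> U \<and> C2_on F U \<and> (\<forall>q\<in>U. grad F q \<noteq> 0) \<and>
        S \<inter> U = {q \<in> U. F q = 0})"

definition tangent_vector :: "(real^3) set \<Rightarrow> real^3 \<Rightarrow> real^3 \<Rightarrow> bool" where
  "tangent_vector S p v \<longleftrightarrow>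
     (\<exists>(\<gamma> :: real \<Rightarrow> real^3) \<delta>. 0 < \<delta> \<and> C1_on \<gamma> {-\<delta><..<\<delta>} \<and> \<gamma> ` {-\<delta><..<\<delta>} \<subseteq> S \<and>
        \<gamma> 0 = p \<and> (\<gamma> has_vector_derivative v) (at 0))"

definition unit_normal_toward :: "(real^3) set \<Rightarrow> (real^3) set \<Rightarrow> real^3 \<Rightarrow> real^3 \<Rightarrow> bool" where
  "unit_normal_toward S M p \<nu> \<longleftrightarrow>
     norm \<nu> = 1 \<and> (\<forall>v. tangent_vector S p v \<longrightarrow> v \<bullet> \<nu> = 0) \<and>
     (\<exists>\<delta>>0. \<forall>t. 0 < t \<and> t < \<delta> \<longrightarrow> p + t *\<^sub>R \<nu> \<in> M)"

text \<open>
  \<open>M1\<close> lies on one side of \<open>S\<close> and \<open>M2\<close> on the other.  The condition is local around \<open>S\<close>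
  because \<open>S\<close> need not extend over the whole horizontal plane.
\<close>

definition separates :: "(real^3) set \<Rightarrow> (real^3) set \<Rightarrow> (real^3) set \<Rightarrow> bool" where
  "separates S M1 M2 \<longleftrightarrow>
     open M1 \<and> open M2 \<and> M1 \<inter> M2 = {} \<and> S \<subseteq> frontier M1 \<inter> frontier M2 \<and>
     (\<exists>U. open U \<and> S \<subseteq> U \<and> U \<subseteq> M1 \<union> S \<union> M2)"

text \<open>Vertical order relative to \<open>S\<close> is compared only along vertical lines that meet \<open>S\<close>.\<close>

definition lies_below :: "(real^3) set \<Rightarrow> (real^3) set \<Rightarrow> bool" where
  "lies_below M S \<longleftrightarrow> (\<forall>p\<in>M. \<forall>s\<in>S. horiz p = horiz s \<longrightarrow> p $ 3 < s $ 3)"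

definition lies_between :: "(real^3) set \<Rightarrow> (real^3) set \<Rightarrow> real \<Rightarrow> bool" where
  "lies_between M S a \<longleftrightarrow>
     (\<forall>p\<in>M. p $ 3 < a \<and> (\<forall>s\<in>S. horiz p = horiz s \<longrightarrow> s $ 3 < p $ 3))"

text \<open>The ray from \<open>p\<close> in the unit direction \<open>v\<close> meets \<open>S\<close> for the first time at distance \<open>t\<close>.\<close>

definition strikes_at :: "real^3 \<Rightarrow> real^3 \<Rightarrow> (real^3) set \<Rightarrow> real \<Rightarrow> bool" where
  "strikes_at p v S t \<longleftrightarrow>
     0 < t \<and> p + t *\<^sub>R v \<in> S \<and> (\<forall>s. 0 \<le> s \<and> s < t \<longrightarrow> p + s *\<^sub>R v \<notin> S)"

text \<open>Generalized Snell law across a horizontal metasurface, whose upward normal is \<open>e3\<close>.\<close>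

definition generalized_snell ::
  "real \<Rightarrow> real \<Rightarrow> (real^3 \<Rightarrow> real) \<Rightarrow> real^3 \<Rightarrow> real^3 \<Rightarrow> real^3 \<Rightarrow> bool" where
  "generalized_snell k \<kappa> \<phi> u m w \<longleftrightarrow>
     (let q = m - (1 / k) *\<^sub>R grad \<phi> u;
          r = \<kappa>\<^sup>2 - (norm q)\<^sup>2 + (q $ 3)\<^sup>2;
          \<mu> = q $ 3 - sqrt r
      in 0 \<le> r \<and> q - \<kappa> *\<^sub>R w = \<mu> *\<^sub>R e3)"

end

theory Submission
  imports Defs
begin

text \<open>
  By Fermat's principle the optical path from \<open>(x, 0)\<close> to the metasurface, corrected by the phase,
  is a potential: \<open>h = (\<kappa>\<^sub>1 / k) \<phi>(Q, a) - \<rho> - \<kappa>\<^sub>1 d\<close>.  Write \<open>D\<close> for the derivative in a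
  direction \<open>v\<close>.  From \<open>(Q, a) = P + d m\<close>, \<open>norm m = 1\<close> and \<open>\<kappa>\<^sub>1 m = e - lam \<nu>\<close> with
  \<open>D P\<close> orthogonal to \<open>\<nu>\<close>, one gets \<open>\<kappa>\<^sub>1 m \<bullet> D (Q, a) = e' \<bullet> v + D \<rho> + \<kappa>\<^sub>1 D d\<close>.  As \<open>D (Q, a)\<close> is
  horizontal, the generalized Snell law turns the left-hand side into \<open>(\<kappa>\<^sub>1 / k) D (\<phi>(Q, a))\<close>.
  The differentiability of \<open>d\<close> and \<open>Q\<close> rests on that of \<open>\<nu>\<close>, which by \<open>\<nu>\<^sub>3 > 0\<close> equals
  \<open>\<plusminus>\<nabla>F / norm \<nabla>F\<close> along \<open>P\<close>, with locally constant sign, for a local equation \<open>F = 0\<close> of \<open>\<sigma>\<^sub>1\<close>.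
\<close>

section \<open>Gradients and classes of differentiability\<close>

lemma partial_deriv_eq:
  fixes f :: "real^'n \<Rightarrow> real"
  assumes "(f has_derivative f') (at x)"
  shows "partial_deriv f i x = f' (axis i 1)"
proof -
  have "((\<lambda>t. f (x + t *\<^sub>R axis i 1)) has_derivative (\<lambda>t. f' (t *\<^sub>R axis i 1))) (at 0)"
    by (rule has_derivative_compose[of "\<lambda>t. x + t *\<^sub>R axis i 1" "\<lambda>t. t *\<^sub>R axis i 1" 0 UNIV f f'])
      (auto intro!: derivative_eq_intros simp: assms)
  moreover have "f' (t *\<^sub>R axis i 1) = f' (axis i 1) * t" for t
    using has_derivative_linear[OF assms] by (simp add: linear_scale)
  ultimately have "((\<lambda>t. f (x + t *\<^sub>R axis i 1)) has_real_derivative f' (axis i 1)) (at 0)"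
    by (simp add: has_field_derivative_def)
  then show ?thesis
    unfolding partial_deriv_def by (rule DERIV_imp_deriv)
qed

text \<open>By linearity the values on the axes determine a derivative, so \<open>grad\<close>,
  built from one-variable derivatives, represents the whole Frechet derivative.\<close>

lemma grad_inner:
  assumes "(f has_derivative f') (at x)"
  shows "grad f x \<bullet> v = f' v"
proof -
  interpret linear f' by (rule has_derivative_linear[OF assms])
  have "f' v = f' (\<Sum>i\<in>UNIV. v $ i *\<^sub>R axis i 1)"
    by (simp only: basis_expansion flip: scalar_mult_eq_scaleR)
  also have "\<dots> = (\<Sum>i\<in>UNIV. v $ i * f' (axis i 1))"
    by (simp add: sum scale)
  finally show ?thesis
    by (simp add: grad_def partial_deriv_eq[OF assms] inner_vec_def mult.commute)
qed

lemma grad_eqI: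
  assumes "(f has_derivative (\<lambda>v. g \<bullet> v)) (at x)"
  shows "grad f x = g"
proof -
  have "grad f x \<bullet> v = g \<bullet> v" for v
    by (rule grad_inner[OF assms])
  then show ?thesis
    using vector_eq_rdot[of "grad f x" g] by simp
qed

lemma C1_on_differentiable: "C1_on f S \<Longrightarrow> x \<in> S \<Longrightarrow> f differentiable (at x)"
  unfolding C1_on_def differentiable_def by blast

lemma C2_on_imp_C1_on:
  assumes "C2_on f S"
  shows "C1_on f S"
proof -
  obtain f' :: "'a \<Rightarrow> 'a \<Rightarrow>\<^sub>L 'b"
    where f': "\<forall>x\<in>S. (f has_derivative blinfun_apply (f' x)) (at x)" and "C1_on f' S"
    using assms unfolding C2_on_def by blast
  have "continuous_on S f'"
    by (intro continuous_at_imp_continuous_on ballI differentiable_imp_continuous_within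
        C1_on_differentiable[OF \<open>C1_on f' S\<close>])
  with f' show ?thesis
    unfolding C1_on_def by blast
qed

lemma differentiable_transform_open:
  assumes "f differentiable (at x)" "open S" "x \<in> S" "\<And>y. y \<in> S \<Longrightarrow> f y = g y"
  shows "g differentiable (at x)"
  using assms has_derivative_transform_within_open unfolding differentiable_def by blast

text \<open>On \<open>U\<close> the gradient is the image of the derivative \<open>f'\<close>,
  differentiable at \<open>p\<close>, under a fixed bounded linear map. Since \<open>U\<close> is
  open, agreement there is enough.\<close>

lemma differentiable_grad:
  fixes f :: "real^'n \<Rightarrow> real"
  assumes "C2_on f U" "open U" "p \<in> U"
  shows "grad f differentiable (at p)"
proof -
  obtain f' where f': "\<And>x. x \<in> U \<Longrightarrow> (f has_derivative blinfun_apply (f' x)) (at x)"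
    and "C1_on f' U"
    using assms(1) unfolding C2_on_def by blast
  have df: "f' differentiable (at p)"
    by (rule C1_on_differentiable[OF \<open>C1_on f' U\<close> assms(3)])
  \<comment> \<open>\<open>L\<close> turns a functional into the vector of its values on the
    axes.\<close>
  define L where "L = (\<lambda>F :: (real^'n) \<Rightarrow>\<^sub>L real. \<Sum>i\<in>UNIV. F (axis i 1) *\<^sub>R axis i (1::real))"
  have "bounded_linear L"
    unfolding L_def
    by (intro bounded_linear_sum bounded_linear_scaleR_const blinfun.bounded_linear_left)
  then have "(\<lambda>x. L (f' x)) differentiable (at p)"
    by (intro differentiable_compose[OF _ df] bounded_linear_imp_differentiable)
  moreover have "L (f' x) = grad f x" if "x \<in> U" for x
  proof -
    have "grad f x = (\<Sum>i\<in>UNIV. grad f x $ i *\<^sub>R axis i 1)"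
      by (simp only: basis_expansion flip: scalar_mult_eq_scaleR)
    then show ?thesis
      by (simp add: L_def grad_def partial_deriv_eq[OF f'[OF that]])
  qed
  ultimately show ?thesis
    using differentiable_transform_open[OF _ assms(2,3), of "\<lambda>x. L (f' x)" "grad f"] by simp
qed

section \<open>Symmetry of second derivatives\<close>

text \<open>The mean value theorem along \<open>u\<close> reduces the second difference to an
  increment of \<open>f'\<close> in the direction \<open>v\<close>, which the linear expansion of
  \<open>f'\<close> at \<open>x\<close> evaluates. Differentiability of \<open>f'\<close> at the
  single point \<open>x\<close> suffices.\<close>

lemma symmetric_second_derivative_aux:
  fixes f :: "'a::real_normed_vector \<Rightarrow> real" and f' :: "'a \<Rightarrow> 'a \<Rightarrow>\<^sub>L real"
  assumes S: "open S" "x \<in> S"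
    and f': "\<And>y. y \<in> S \<Longrightarrow> (f has_derivative blinfun_apply (f' y)) (at y)"
    and A: "(f' has_derivative A) (at x)"
  shows "((\<lambda>t. (f (x + t *\<^sub>R u + t *\<^sub>R v) - f (x + t *\<^sub>R u) - f (x + t *\<^sub>R v) + f x) / t\<^sup>2)
           \<longlongrightarrow> blinfun_apply (A v) u) (at_right 0)"
proof (rule tendstoI)
  \<comment> \<open>Mean value theorem for \<open>\<psi> s = f (x + s u + t v) - f (x + s u)\<close> on \<open>[0, t]\<close>.\<close>
  fix \<epsilon> :: real assume "0 < \<epsilon>"
  interpret A: bounded_linear A by (rule has_derivative_bounded_linear[OF A])
  \<comment> \<open>The remainders at \<open>t\<close> and at \<open>0\<close> together contribute
    at most \<open>\<eta> * (C - 1)\<close> to the quotient, which is below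
    \<open>\<eta> * (2 * C) = \<epsilon>\<close>. The summand 1 keeps \<open>C\<close> positive when
    \<open>u = 0\<close>.\<close>
  define C where "C = 2 * (norm u + norm v) * norm u + 1"
  have "0 < C" unfolding C_def by (simp add: add_nonneg_pos)
  define \<eta> where "\<eta> = \<epsilon> / (2 * C)"
  have "0 < \<eta>" using \<open>0 < \<epsilon>\<close> \<open>0 < C\<close> by (simp add: \<eta>_def)
  obtain r where r: "0 < r" "ball x r \<subseteq> S"
    using S openE by blast
  obtain \<delta> where \<delta>: "0 < \<delta>"
    and lin: "\<And>y. norm (y - x) < \<delta> \<Longrightarrow> norm (f' y - f' x - A (y - x)) \<le> \<eta> * norm (y - x)"
    using A \<open>0 < \<eta>\<close> unfolding has_derivative_at_alt by blast
  \<comment> \<open>For \<open>t < T\<close> every point \<open>x + s u + c v\<close> with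
    \<open>s\<close>, \<open>c\<close> in \<open>[0, t]\<close> lies in \<open>S\<close> and in the
    range of the estimate \<open>lin\<close>. The summand 1 guards against
    \<open>u = v = 0\<close>.\<close>
  define T where "T = min r \<delta> / (norm u + norm v + 1)"
  have den: "0 < norm u + norm v + 1" by (simp add: add_nonneg_pos)
  have "0 < T" using r \<delta> den by (simp add: T_def)
  have est: "dist ((f (x + t *\<^sub>R u + t *\<^sub>R v) - f (x + t *\<^sub>R u) - f (x + t *\<^sub>R v) + f x) / t\<^sup>2) (A v u) < \<epsilon>"
    if t: "0 < t" "t < T" for t
  proof -
    have tT: "t * (norm u + norm v + 1) < min r \<delta>"
      using t den by (simp add: T_def pos_less_divide_eq)
    have small: "norm (s *\<^sub>R u + c *\<^sub>R v) \<le> t * (norm u + norm v)"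
      "norm (s *\<^sub>R u + c *\<^sub>R v) < min r \<delta>" if "0 \<le> s" "s \<le> t" "0 \<le> c" "c \<le> t" for s c
    proof -
      have "norm (s *\<^sub>R u + c *\<^sub>R v) \<le> s * norm u + c * norm v"
        using norm_triangle_ineq[of "s *\<^sub>R u" "c *\<^sub>R v"] that by simp
      also have "\<dots> \<le> t * norm u + t * norm v"
        using that by (intro add_mono mult_right_mono) auto
      finally show "norm (s *\<^sub>R u + c *\<^sub>R v) \<le> t * (norm u + norm v)"
        by (simp add: algebra_simps)
      then show "norm (s *\<^sub>R u + c *\<^sub>R v) < min r \<delta>"
        using tT t by (simp add: algebra_simps)
    qed
    have inS: "x + s *\<^sub>R u + c *\<^sub>R v \<in> S" if "0 \<le> s" "s \<le> t" "0 \<le> c" "c \<le> t" for s c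
      using small(2)[OF that] r by (auto simp: subset_iff dist_norm add.assoc norm_minus_commute)
    \<comment> \<open>The term \<open>0 *\<^sub>R v\<close> is kept so that both summands are
      instances, with \<open>c = t\<close> and \<open>c = 0\<close>, of one expression
      \<open>x + s u + c v\<close>.\<close>
    define \<psi> where "\<psi> s = f (x + s *\<^sub>R u + t *\<^sub>R v) - f (x + s *\<^sub>R u + 0 *\<^sub>R v)" for s
    have der: "(\<psi> has_derivative (\<lambda>h. h * (f' (x + s *\<^sub>R u + t *\<^sub>R v) u - f' (x + s *\<^sub>R u + 0 *\<^sub>R v) u))) (at s)"
      if "0 \<le> s" "s \<le> t" for s
    proof -
      have "((\<lambda>s. f (x + s *\<^sub>R u + c *\<^sub>R v)) has_derivative (\<lambda>h. f' (x + s *\<^sub>R u + c *\<^sub>R v) (h *\<^sub>R u))) (at s)"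
        if "0 \<le> c" "c \<le> t" for c
        by (rule has_derivative_compose[of "\<lambda>s. x + s *\<^sub>R u + c *\<^sub>R v" _ s UNIV f])
          (use \<open>0 \<le> s\<close> \<open>s \<le> t\<close> that in \<open>auto intro!: derivative_eq_intros f' inS\<close>)
      from has_derivative_diff[OF this[of t] this[of 0]] t show ?thesis
        unfolding \<psi>_def by (simp add: blinfun.bilinear_simps right_diff_distrib)
    qed
    have "\<exists>\<xi>\<in>{0<..<t}. \<psi> t - \<psi> 0 =
        (t - 0) * (f' (x + \<xi> *\<^sub>R u + t *\<^sub>R v) u - f' (x + \<xi> *\<^sub>R u + 0 *\<^sub>R v) u)"
      by (rule mvt_simple[OF t(1)]) (use der in \<open>auto intro: has_derivative_at_withinI simp del: scaleR_zero_left\<close>)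
    then obtain \<xi> where \<xi>: "0 < \<xi>" "\<xi> < t"
      and mvt: "\<psi> t - \<psi> 0 = t * (f' (x + \<xi> *\<^sub>R u + t *\<^sub>R v) u - f' (x + \<xi> *\<^sub>R u + 0 *\<^sub>R v) u)"
      by auto
    define R where "R c = f' (x + \<xi> *\<^sub>R u + c *\<^sub>R v) - f' x - A (\<xi> *\<^sub>R u + c *\<^sub>R v)" for c
    have R: "norm (R c) \<le> \<eta> * (t * (norm u + norm v))" if "0 \<le> c" "c \<le> t" for c
    proof -
      have "norm (R c) \<le> \<eta> * norm (\<xi> *\<^sub>R u + c *\<^sub>R v)"
        using lin[of "x + \<xi> *\<^sub>R u + c *\<^sub>R v"] small(2)[of \<xi> c] \<xi> that
        by (simp add: R_def add.assoc)
      also have "\<dots> \<le> \<eta> * (t * (norm u + norm v))"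
        using small(1)[of \<xi> c] \<xi> that \<open>0 < \<eta>\<close> by (intro mult_left_mono) auto
      finally show ?thesis .
    qed
    \<comment> \<open>The linear parts at the two points share \<open>A (\<xi> *\<^sub>R u)\<close>;
      it cancels, so the unknown \<open>\<xi>\<close> survives only in the remainders.\<close>
    have "f' (x + \<xi> *\<^sub>R u + t *\<^sub>R v) - f' (x + \<xi> *\<^sub>R u + 0 *\<^sub>R v) = R t - R 0 + t *\<^sub>R A v"
      by (simp add: R_def A.add A.scaleR)
    then have "\<psi> t - \<psi> 0 = t * ((R t - R 0) u + t * A v u)"
      unfolding mvt by (simp flip: blinfun.diff_left add: blinfun.add_left blinfun.scaleR_left)
    then have q: "(\<psi> t - \<psi> 0) / t\<^sup>2 - A v u = (R t - R 0) u / t"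
      using t by (simp add: power2_eq_square field_simps)
    have "\<bar>(R t - R 0) u\<bar> \<le> norm (R t - R 0) * norm u"
      using norm_blinfun[of "R t - R 0" u] by simp
    also have "\<dots> \<le> (2 * (\<eta> * (t * (norm u + norm v)))) * norm u"
      using norm_triangle_ineq4[of "R t" "R 0"] R[of t] R[of 0] t by (intro mult_right_mono) auto
    also have "\<dots> = t * (\<eta> * (C - 1))"
      by (simp add: C_def algebra_simps)
    finally have "\<bar>(R t - R 0) u / t\<bar> \<le> \<eta> * (C - 1)"
      using t by (simp add: abs_divide pos_divide_le_eq mult.commute)
    also have "\<dots> < \<eta> * (2 * C)"
      using \<open>0 < \<eta>\<close> \<open>0 < C\<close> by simp
    also have "\<dots> = \<epsilon>" using \<open>0 < C\<close> by (simp add: \<eta>_def)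
    finally show ?thesis
      using q by (simp add: dist_real_def \<psi>_def algebra_simps)
  qed
  show "\<forall>\<^sub>F t in at_right 0. dist ((f (x + t *\<^sub>R u + t *\<^sub>R v) - f (x + t *\<^sub>R u) - f (x + t *\<^sub>R v) + f x) / t\<^sup>2) (A v u) < \<epsilon>"
    using est \<open>0 < T\<close> by (auto simp: eventually_at_right_field)
qed

text \<open>The second difference does not change when \<open>u\<close> and \<open>v\<close> are
  exchanged, so its two limits coincide.\<close>

lemma symmetric_second_derivative:
  fixes f :: "'a::real_normed_vector \<Rightarrow> real" and f' :: "'a \<Rightarrow> 'a \<Rightarrow>\<^sub>L real"
  assumes "open S" "x \<in> S"
    and "\<And>y. y \<in> S \<Longrightarrow> (f has_derivative blinfun_apply (f' y)) (at y)"
    and "(f' has_derivative A) (at x)"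
  shows "blinfun_apply (A u) v = blinfun_apply (A v) u"
proof (rule tendsto_unique)
  let ?\<Delta> = "\<lambda>t. (f (x + t *\<^sub>R u + t *\<^sub>R v) - f (x + t *\<^sub>R u) - f (x + t *\<^sub>R v) + f x) / t\<^sup>2"
  show "(?\<Delta> \<longlongrightarrow> A v u) (at_right 0)"
    by (rule symmetric_second_derivative_aux[OF assms])
  show "(?\<Delta> \<longlongrightarrow> A u v) (at_right 0)"
    using symmetric_second_derivative_aux[OF assms, of v u] by (simp add: algebra_simps)
qed simp

section \<open>Tangent vectors and unit normals of level surfaces\<close>

text \<open>A unit normal is required to be orthogonal only to velocities of actual curves in
  \<open>S\<close>. To compare it with the gradient, each \<open>v\<close> orthogonal to the
  gradient must be realised by such a curve, which the inverse function theorem supplies.\<close>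

lemma tangent_vector_level_set:
  fixes F :: "real^3 \<Rightarrow> real"
  assumes F: "C1_on F U" and "open U" "p \<in> U" "p \<in> S"
    and level: "S \<inter> U = {q \<in> U. F q = 0}"
    and nz: "grad F p \<noteq> 0" and v: "v \<bullet> grad F p = 0"
  shows "tangent_vector S p v"
proof -
  obtain F' where F': "\<And>q. q \<in> U \<Longrightarrow> (F has_derivative blinfun_apply (F' q)) (at q)"
    and contF': "continuous_on U F'"
    using F unfolding C1_on_def by blast
  define G where "G = grad F p"
  define c where "c = 1 / (G \<bullet> G)"
  have "G \<bullet> G \<noteq> 0" using nz by (simp add: G_def)
  then have c: "c * (G \<bullet> G) = 1" by (simp add: c_def)
  have F'p: "F' p w = w \<bullet> G" for w
    using grad_inner[OF F'[OF \<open>p \<in> U\<close>]] by (simp add: G_def inner_commute)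
  \<comment> \<open>\<open>H\<close> straightens \<open>F = 0\<close> to the plane through \<open>p\<close> orthogonal to \<open>G\<close>; it is scaled so that its
    derivative at \<open>p\<close> is the identity, and the curve sought is the preimage of a line.\<close>
  define H where "H q = q + (c * (F q - (q - p) \<bullet> G)) *\<^sub>R G" for q
  define H' where "H' q = id_blinfun + (blinfun_scaleR_left G o\<^sub>L (c *\<^sub>R (F' q - blinfun_inner_left G)))" for q
  have H'_apply: "H' q w = w + (c * (F' q w - w \<bullet> G)) *\<^sub>R G" for q w
    by (simp add: H'_def blinfun.bilinear_simps)
  have derH: "(H has_derivative blinfun_apply (H' q)) (at q)" if "q \<in> U" for q
    unfolding H_def H'_apply[abs_def]
    by (auto intro!: derivative_eq_intros F' that simp: algebra_simps)
  have contH: "continuous_on U H'"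
    unfolding H'_def by (intro continuous_intros contF')
  have inv: "id_blinfun o\<^sub>L H' p = id_blinfun"
    by (rule blinfun_eqI) (simp add: H'_apply F'p)
  show ?thesis
  proof (rule inverse_function_theorem[OF \<open>open U\<close> derH contH \<open>p \<in> U\<close> inv])
    fix U' V g g'
    assume "open U'" and U': "U' \<subseteq> U" "p \<in> U'" and "open V" and "H p \<in> V"
      and hom: "homeomorphism U' V H g"
      and derg: "\<And>y. y \<in> V \<Longrightarrow> (g has_derivative (g' y)) (at y)"
      and g': "\<And>y. y \<in> V \<Longrightarrow> g' y = inv (blinfun_apply (H' (g y)))"
      and bij: "\<And>y. y \<in> V \<Longrightarrow> bij (blinfun_apply (H' (g y)))"
    have "F p = 0" using level \<open>p \<in> U\<close> \<open>p \<in> S\<close> by blast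
    then have Hp: "H p = p" by (simp add: H_def)
    have gU: "g y \<in> U'" and Hg: "H (g y) = y" if "y \<in> V" for y
      using hom that unfolding homeomorphism_def by auto
    have gp: "g p = p"
      using homeomorphism_apply1[OF hom U'(2)] Hp by simp
    \<comment> \<open>\<open>H' (g y)\<close> maps \<open>G\<close> to the multiple
      \<open>c * F' (g y) G\<close> of \<open>G\<close>, so a zero factor would contradict
      injectivity.\<close>
    have F'G: "F' (g y) G \<noteq> 0" if "y \<in> V" for y
    proof
      assume "F' (g y) G = 0"
      then have "H' (g y) G = H' (g y) 0"
        using c by (simp add: H'_apply)
      then have "G = 0"
        by (rule injD[OF bij_is_inj[OF bij[OF that]]])
      then show False using nz by (simp add: G_def)
    qed
    \<comment> \<open>Solving \<open>H' (g y) w = v\<close> explicitly, with \<open>v\<close>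
      orthogonal to \<open>G\<close>, exhibits the velocity of the curve as a continuous expression
      in \<open>F'\<close>, as \<open>C1_on\<close> demands.\<close>
    have g'v: "g' y v = v - (F' (g y) v / F' (g y) G) *\<^sub>R G" if "y \<in> V" for y
    proof -
      have "H' (g y) (v - (F' (g y) v / F' (g y) G) *\<^sub>R G) = v"
        using F'G[OF that] c v
        by (simp add: H'_apply blinfun.bilinear_simps inner_diff_left G_def[symmetric] algebra_simps)
      then show ?thesis
        unfolding g'[OF that] by (intro inv_f_eq bij_is_inj[OF bij[OF that]])
    qed
    define \<gamma> where "\<gamma> t = g (p + t *\<^sub>R v)" for t
    have "open ((\<lambda>t. p + t *\<^sub>R v) -` V)"
      by (intro continuous_open_vimage \<open>open V\<close>) (auto intro!: continuous_intros)
    moreover have "(0::real) \<in> (\<lambda>t. p + t *\<^sub>R v) -` V"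
      using \<open>H p \<in> V\<close> Hp by simp
    ultimately obtain \<delta> where "0 < \<delta>" and ball: "ball 0 \<delta> \<subseteq> (\<lambda>t. p + t *\<^sub>R v) -` V"
      using openE by blast
    have inV: "p + t *\<^sub>R v \<in> V" if "t \<in> {-\<delta><..<\<delta>}" for t
      using ball that by (auto simp: subset_iff dist_real_def abs_less_iff)
    have der: "(\<gamma> has_derivative (\<lambda>h. h *\<^sub>R g' (p + t *\<^sub>R v) v)) (at t)" if "t \<in> {-\<delta><..<\<delta>}" for t
    proof -
      note d = derg[OF inV[OF that]]
      have "(\<gamma> has_derivative (\<lambda>h. g' (p + t *\<^sub>R v) (h *\<^sub>R v))) (at t)"
        unfolding \<gamma>_def
        by (rule has_derivative_compose[of "\<lambda>t. p + t *\<^sub>R v" "\<lambda>h. h *\<^sub>R v" t UNIV g])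
          (auto intro!: derivative_eq_intros d)
      then show ?thesis
        by (simp add: linear_scale[OF has_derivative_linear[OF d]])
    qed
    have cont\<gamma>: "continuous_on {-\<delta><..<\<delta>} \<gamma>"
      using der by (blast intro: continuous_at_imp_continuous_on has_derivative_continuous)
    have \<gamma>U: "\<gamma> t \<in> U" if "t \<in> {-\<delta><..<\<delta>}" for t
      using gU[OF inV[OF that]] U' by (auto simp: \<gamma>_def)
    have "continuous_on {-\<delta><..<\<delta>} (\<lambda>t. F' (\<gamma> t))"
      by (rule continuous_on_compose2[OF contF' cont\<gamma>]) (use \<gamma>U in blast)
    then have "continuous_on {-\<delta><..<\<delta>} (\<lambda>t. v - (F' (\<gamma> t) v / F' (\<gamma> t) G) *\<^sub>R G)"
      using F'G[OF inV] unfolding \<gamma>_def by (intro continuous_intros) auto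
    then have "continuous_on {-\<delta><..<\<delta>} (\<lambda>t. g' (p + t *\<^sub>R v) v)"
      by (rule continuous_on_eq) (simp add: g'v[OF inV] \<gamma>_def)
    then have "continuous_on {-\<delta><..<\<delta>} (\<lambda>t. blinfun_scaleR_left (g' (p + t *\<^sub>R v) v))"
      by (intro continuous_intros)
    with der have "C1_on \<gamma> {-\<delta><..<\<delta>}"
      unfolding C1_on_def by (intro exI[of _ "\<lambda>t. blinfun_scaleR_left (g' (p + t *\<^sub>R v) v)"]) simp
    moreover have "\<gamma> t \<in> S" if "t \<in> {-\<delta><..<\<delta>}" for t
    proof -
      \<comment> \<open>Pairing \<open>H (\<gamma> t) = p + t v\<close> with \<open>G\<close> in two
        ways isolates \<open>F (\<gamma> t)\<close>: the terms linear in \<open>\<gamma> t\<close>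
        cancel.\<close>
      have "H (\<gamma> t) \<bullet> G = p \<bullet> G"
        using Hg[OF inV[OF that]] v by (simp add: \<gamma>_def inner_add_left G_def)
      moreover have "H (\<gamma> t) \<bullet> G = \<gamma> t \<bullet> G + (c * (G \<bullet> G)) * (F (\<gamma> t) - (\<gamma> t - p) \<bullet> G)"
        by (simp add: H_def inner_add_left)
      ultimately have "F (\<gamma> t) = 0"
        by (simp add: c inner_diff_left)
      then show ?thesis using level \<gamma>U[OF that] by blast
    qed
    moreover have "(\<gamma> has_vector_derivative v) (at 0)"
    proof -
      have "g' p v = v"
        using g'v[of p] F'p[of v] v Hp \<open>H p \<in> V\<close> by (simp add: gp G_def)
      then show ?thesis
        using der[of 0] \<open>0 < \<delta>\<close> by (simp add: has_vector_derivative_def)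
    qed
    ultimately show ?thesis
      unfolding tangent_vector_def
      using \<open>0 < \<delta>\<close> gp by (intro exI[of _ \<gamma>] exI[of _ \<delta>]) (auto simp: \<gamma>_def)
  qed
qed

text \<open>The part of \<open>\<nu>\<close> orthogonal to the gradient is tangent, hence orthogonal
  to \<open>\<nu>\<close>, hence zero. Unit length then fixes the modulus of the factor, and
  \<open>0 < \<nu> $ 3\<close> fixes its sign.\<close>

lemma unit_normal_level_set:
  fixes F :: "real^3 \<Rightarrow> real"
  assumes "C1_on F U" and "open U" "p \<in> U" "p \<in> S"
    and "S \<inter> U = {q \<in> U. F q = 0}" and nz: "grad F p \<noteq> 0"
    and \<nu>: "unit_normal_toward S M p \<nu>" "0 < \<nu> $ 3"
  shows "grad F p $ 3 \<noteq> 0" "\<nu> = (sgn (grad F p $ 3) / norm (grad F p)) *\<^sub>R grad F p"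
proof -
  define G where "G = grad F p"
  define c where "c = (\<nu> \<bullet> G) / (G \<bullet> G)"
  define v where "v = \<nu> - c *\<^sub>R G"
  have "G \<noteq> 0" using nz by (simp add: G_def)
  then have vG: "v \<bullet> G = 0"
    by (simp add: v_def c_def inner_diff_left)
  then have "tangent_vector S p v"
    by (intro tangent_vector_level_set[OF assms(1-6)]) (simp add: G_def)
  then have "v \<bullet> \<nu> = 0"
    using \<nu> by (simp add: unit_normal_toward_def)
  then have "v \<bullet> v = 0"
    using vG by (simp add: v_def inner_diff_right)
  then have eq: "\<nu> = c *\<^sub>R G"
    by (simp add: v_def)
  have "\<bar>c\<bar> * norm G = 1"
    using \<nu>(1) eq by (simp add: unit_normal_toward_def)
  then have abs: "\<bar>c\<bar> = 1 / norm G"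
    using \<open>G \<noteq> 0\<close> by (simp add: field_simps)
  have pos: "0 < c * G $ 3"
    using \<nu>(2) eq by simp
  then show "grad F p $ 3 \<noteq> 0" by (auto simp: G_def)
  have "c = sgn (G $ 3) * \<bar>c\<bar>"
    using pos by (auto simp: zero_less_mult_iff)
  then have "c = sgn (G $ 3) / norm G"
    by (simp add: abs)
  then show "\<nu> = (sgn (grad F p $ 3) / norm (grad F p)) *\<^sub>R grad F p"
    using eq by (simp add: G_def)
qed

lemma eventually_sgn_eq:
  fixes f :: "'a::t2_space \<Rightarrow> real"
  assumes "isCont f x" "f x \<noteq> 0"
  shows "\<forall>\<^sub>F y in nhds x. sgn (f y) = sgn (f x)"
proof -
  have lim: "(f \<longlongrightarrow> f x) (nhds x)"
    using assms(1) by (simp add: isCont_def tendsto_at_iff_tendsto_nhds)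
  show ?thesis
  proof (cases "0 < f x")
    case True
    then show ?thesis
      using order_tendstoD(1)[OF lim, of 0] by (auto elim!: eventually_mono)
  next
    case False
    then show ?thesis
      using order_tendstoD(2)[OF lim, of 0] assms(2) by (auto elim!: eventually_mono)
  qed
qed

text \<open>Near \<open>x\<close> the third component of the gradient along \<open>P\<close> keeps
  its sign, so the normal is a constant sign times the normalised gradient, which is differentiable.
  Orthogonality comes from differentiating \<open>F (P y) = 0\<close>.\<close>

lemma unit_normal_field:
  fixes P \<nu> :: "'a::real_normed_vector \<Rightarrow> real^3"
  assumes S: "C2_surface S" and "open \<Omega>" "x \<in> \<Omega>"
    and PS: "\<And>y. y \<in> \<Omega> \<Longrightarrow> P y \<in> S"
    and P': "(P has_derivative P') (at x)" and contP: "continuous_on \<Omega> P"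
    and \<nu>: "\<And>y. y \<in> \<Omega> \<Longrightarrow> unit_normal_toward S M (P y) (\<nu> y)" "\<And>y. y \<in> \<Omega> \<Longrightarrow> 0 < \<nu> y $ 3"
  shows "\<nu> differentiable (at x)" "P' v \<bullet> \<nu> x = 0"
proof -
  obtain U F where U: "open U" "P x \<in> U" and F: "C2_on F U" "\<And>q. q \<in> U \<Longrightarrow> grad F q \<noteq> 0"
    and level: "S \<inter> U = {q \<in> U. F q = 0}"
    using bspec[OF S[unfolded C2_surface_def] PS[OF \<open>x \<in> \<Omega>\<close>]] by (elim exE conjE) simp
  have C1: "C1_on F U" by (rule C2_on_imp_C1_on[OF F(1)])
  then obtain F' where F': "\<And>q. q \<in> U \<Longrightarrow> (F has_derivative blinfun_apply (F' q)) (at q)"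
    unfolding C1_on_def by blast
  define W where "W = \<Omega> \<inter> P -` U"
  have W: "open W" "x \<in> W"
    using continuous_open_preimage[OF contP \<open>open \<Omega>\<close> U(1)] \<open>x \<in> \<Omega>\<close> U(2) by (auto simp: W_def)
  have W_D: "y \<in> \<Omega>" "P y \<in> U" "P y \<in> S" if "y \<in> W" for y
    using that PS by (auto simp: W_def)
  define G where "G y = grad F (P y)" for y
  have normal: "G y $ 3 \<noteq> 0" "\<nu> y = (sgn (G y $ 3) / norm (G y)) *\<^sub>R G y" if "y \<in> W" for y
    unfolding G_def
    by (rule unit_normal_level_set[OF C1 U(1) W_D(2,3)[OF that] level F(2)[OF W_D(2)[OF that]]
          \<nu>[OF W_D(1)[OF that]]])+
  have dP: "P differentiable (at x)" using P' by (rule differentiableI)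
  have dG: "G differentiable (at x)"
    unfolding G_def by (rule differentiable_compose[OF differentiable_grad[OF F(1) U] dP])
  have Gnz: "G x \<noteq> 0" using F(2) U(2) by (simp add: G_def)
  have "isCont G x" using dG by (rule differentiable_imp_continuous_within)
  then have "isCont (\<lambda>y. G y $ 3) x" by (intro continuous_intros)
  from eventually_sgn_eq[OF this normal(1)[OF W(2)]]
  have "\<forall>\<^sub>F y in nhds x. sgn (G y $ 3) = sgn (G x $ 3)" .
  then obtain W' where W': "open W'" "x \<in> W'" "\<And>y. y \<in> W' \<Longrightarrow> sgn (G y $ 3) = sgn (G x $ 3)"
    unfolding eventually_nhds by blast
  have "(\<lambda>y. norm (G y)) differentiable (at x)"
    by (rule differentiable_compose[OF differentiable_norm_at[OF Gnz] dG])
  then have "(\<lambda>y. (sgn (G x $ 3) / norm (G y)) *\<^sub>R G y) differentiable (at x)"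
    using Gnz dG by (intro differentiable_scaleR differentiable_divide) auto
  then show "\<nu> differentiable (at x)"
  proof (rule differentiable_transform_open)
    show "open (W \<inter> W')" "x \<in> W \<inter> W'" using W W' by auto
    show "(sgn (G x $ 3) / norm (G y)) *\<^sub>R G y = \<nu> y" if "y \<in> W \<inter> W'" for y
      using that normal(2)[of y] W'(3)[of y] by simp
  qed
  have F0: "0 = F (P y)" if "y \<in> W" for y
  proof -
    have "P y \<in> S \<inter> U" using W_D[OF that] by simp
    then show ?thesis unfolding level by simp
  qed
  have "((\<lambda>y. F (P y)) has_derivative (\<lambda>v. F' (P x) (P' v))) (at x)"
    by (rule has_derivative_compose[OF P' F'[OF U(2)]])
  moreover have "((\<lambda>y. F (P y)) has_derivative (\<lambda>v. 0)) (at x)"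
    by (rule has_derivative_transform_within_open[OF has_derivative_const[of 0] W F0])
  ultimately have "(\<lambda>v. F' (P x) (P' v)) = (\<lambda>v. 0)"
    by (rule has_derivative_unique)
  then have "G x \<bullet> P' v = 0"
    using grad_inner[OF F'[OF U(2)]] by (simp add: G_def fun_eq_iff)
  then show "P' v \<bullet> \<nu> x = 0"
    using normal(2)[OF W(2)] by (simp add: inner_commute)
qed

section \<open>Unit fields and the laws of refraction\<close>

text \<open>Differentiate the constant function \<open>f y \<bullet> f y\<close>.\<close>

lemma unit_field_orthogonal:
  fixes f :: "'a::real_normed_vector \<Rightarrow> 'b::real_inner"
  assumes f': "(f has_derivative f') (at x)" and "open S" "x \<in> S"
    and unit: "\<And>y. y \<in> S \<Longrightarrow> norm (f y) = 1"
  shows "f' v \<bullet> f x = 0"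
proof -
  have "((\<lambda>y. f y \<bullet> f y) has_derivative (\<lambda>v. f x \<bullet> f' v + f' v \<bullet> f x)) (at x)"
    by (rule has_derivative_inner[OF f' f'])
  moreover have "((\<lambda>y. f y \<bullet> f y) has_derivative (\<lambda>v. 0)) (at x)"
    by (rule has_derivative_transform_within_open[OF has_derivative_const[of 1] assms(2,3)])
      (use unit in \<open>simp add: dot_square_norm\<close>)
  ultimately have "(\<lambda>v. f x \<bullet> f' v + f' v \<bullet> f x) = (\<lambda>v. 0)"
    by (rule has_derivative_unique)
  from fun_cong[OF this, of v] show ?thesis
    by (simp add: inner_commute)
qed

text \<open>With \<open>s\<close> the square root, \<open>1 < \<kappa>\<close> gives
  \<open>e \<bullet> \<nu> < s\<close>. Completing the square in \<open>l\<close> gives the squared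
  norm of \<open>e - l *\<^sub>R \<nu>\<close> as
  \<open>1 + s\<^sup>2 - (e \<bullet> \<nu>)\<^sup>2\<close>, which is
  \<open>\<kappa>\<^sup>2\<close>.\<close>

lemma snell_refraction:
  fixes e \<nu> :: "'a::real_inner" and \<kappa> :: real
  assumes e: "norm e = 1" and \<nu>: "norm \<nu> = 1" and \<kappa>: "1 < \<kappa>"
  defines "l \<equiv> e \<bullet> \<nu> - sqrt (\<kappa>\<^sup>2 - 1 + (e \<bullet> \<nu>)\<^sup>2)"
  shows "l < 0" and "norm ((1 / \<kappa>) *\<^sub>R (e - l *\<^sub>R \<nu>)) = 1"
proof -
  define s where "s = sqrt (\<kappa>\<^sup>2 - 1 + (e \<bullet> \<nu>)\<^sup>2)"
  have "1 < \<kappa>\<^sup>2" using \<kappa> by (simp add: power2_eq_square less_1_mult)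
  then show "l < 0"
    unfolding l_def by (simp add: real_less_rsqrt)
  have s2: "s\<^sup>2 = \<kappa>\<^sup>2 - 1 + (e \<bullet> \<nu>)\<^sup>2"
    using \<open>1 < \<kappa>\<^sup>2\<close> by (simp add: s_def)
  have "(norm (e - l *\<^sub>R \<nu>))\<^sup>2 = (norm e)\<^sup>2 - 2 * l * (e \<bullet> \<nu>) + l\<^sup>2 * (norm \<nu>)\<^sup>2"
    by (simp only: power2_norm_eq_inner) (simp add: algebra_simps inner_commute power2_eq_square)
  also have "\<dots> = 1 + s\<^sup>2 - (e \<bullet> \<nu>)\<^sup>2"
    by (simp add: e \<nu> l_def s_def[symmetric]) (simp add: power2_eq_square algebra_simps)
  also have "\<dots> = \<kappa>\<^sup>2" by (simp add: s2)
  finally have "norm (e - l *\<^sub>R \<nu>) = \<kappa>"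
    using \<kappa> by (simp add: power2_eq_iff_nonneg)
  then show "norm ((1 / \<kappa>) *\<^sub>R (e - l *\<^sub>R \<nu>)) = 1"
    using \<kappa> by simp
qed

text \<open>All terms of the law other than \<open>m\<close> and the phase gradient are vertical, so
  pairing with a horizontal vector removes them, whatever the value of \<open>\<mu>\<close>.\<close>

lemma generalized_snell_horizontal:
  assumes "generalized_snell k \<kappa> \<phi> u m e3" and "w $ 3 = 0"
  shows "m \<bullet> w = (grad \<phi> u \<bullet> w) / k"
proof -
  obtain \<mu> where "m - (1 / k) *\<^sub>R grad \<phi> u - \<kappa> *\<^sub>R e3 = \<mu> *\<^sub>R e3"
    using assms(1) unfolding generalized_snell_def Let_def by blast
  then have "m = (1 / k) *\<^sub>R grad \<phi> u + (\<mu> + \<kappa>) *\<^sub>R e3"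
    by (simp add: algebra_simps)
  moreover have "e3 \<bullet> w = 0"
    using assms(2) by (simp add: e3_def inner_vec_def sum_3)
  ultimately show ?thesis
    by (simp add: inner_add_left)
qed

section \<open>Horizontal projection, potentials and the planar curl\<close>

lemma linear_horiz: "linear horiz"
  by (rule linearI) (simp_all add: horiz_def vec_eq_iff forall_2)

lemma linear_at_height: "linear (\<lambda>x. at_height x 0)"
  by (rule linearI) (simp_all add: at_height_def vec_eq_iff forall_3)

lemma inner_at_height: "at_height v 0 \<bullet> w = horiz w \<bullet> v"
  by (simp add: at_height_def horiz_def inner_vec_def sum_2 sum_3 mult.commute)

text \<open>The derivative of \<open>h\<close> is \<open>g\<close> followed by the bounded linear
  map that identifies vectors with functionals, and such a map preserves C1 regularity.\<close>

lemma C2_onI_gradient: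
  fixes h :: "'a::real_inner \<Rightarrow> real"
  assumes g: "C1_on g S" and h: "\<And>x. x \<in> S \<Longrightarrow> (h has_derivative (\<lambda>v. g x \<bullet> v)) (at x)"
  shows "C2_on h S"
proof -
  obtain g' :: "'a \<Rightarrow> 'a \<Rightarrow>\<^sub>L 'a"
    where g': "\<And>x. x \<in> S \<Longrightarrow> (g has_derivative blinfun_apply (g' x)) (at x)" and "continuous_on S g'"
    using g unfolding C1_on_def by blast
  define J :: "'a \<Rightarrow>\<^sub>L ('a \<Rightarrow>\<^sub>L real)" where "J = Blinfun blinfun_inner_right"
  have J: "blinfun_apply J = blinfun_inner_right"
    unfolding J_def by (rule bounded_linear_Blinfun_apply) (rule bounded_linear_blinfun_inner_right)
  have "C1_on (\<lambda>x. blinfun_inner_right (g x)) S"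
    unfolding C1_on_def
  proof (intro exI[of _ "\<lambda>x. J o\<^sub>L g' x"] conjI ballI)
    show "((\<lambda>x. blinfun_inner_right (g x)) has_derivative blinfun_apply (J o\<^sub>L g' x)) (at x)" if "x \<in> S" for x
      unfolding blinfun_compose.rep_eq comp_def J
      by (rule bounded_linear.has_derivative[OF bounded_linear_blinfun_inner_right g'[OF that]])
    show "continuous_on S (\<lambda>x. J o\<^sub>L g' x)"
      using \<open>continuous_on S g'\<close> by (intro continuous_intros)
  qed
  then show ?thesis
    unfolding C2_on_def using h by (intro exI[of _ "\<lambda>x. blinfun_inner_right (g x)"]) simp
qed

lemma C1_on_bounded_linear:
  assumes L: "bounded_linear L" and g: "C1_on g S"
  shows "C1_on (\<lambda>x. L (g x)) S"
proof -
  obtain g' where g': "\<And>x. x \<in> S \<Longrightarrow> (g has_derivative blinfun_apply (g' x)) (at x)" and "continuous_on S g'"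
    using g unfolding C1_on_def by blast
  show ?thesis
    unfolding C1_on_def
  proof (intro exI[of _ "\<lambda>x. Blinfun L o\<^sub>L g' x"] conjI ballI)
    show "((\<lambda>x. L (g x)) has_derivative blinfun_apply (Blinfun L o\<^sub>L g' x)) (at x)" if "x \<in> S" for x
      unfolding blinfun_compose.rep_eq comp_def bounded_linear_Blinfun_apply[OF L]
      by (rule bounded_linear.has_derivative[OF L g'[OF that]])
    show "continuous_on S (\<lambda>x. Blinfun L o\<^sub>L g' x)"
      using \<open>continuous_on S g'\<close> by (intro continuous_intros)
  qed
qed

text \<open>Up to the identification of vectors with functionals, \<open>b'\<close> is the second
  derivative of \<open>h\<close>; the curl measures its failure to be symmetric.\<close>

lemma curl2_gradient_field:
  fixes b :: "real^2 \<Rightarrow> real^2"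
  assumes "open S" "x \<in> S" and b': "(b has_derivative b') (at x)"
    and h: "\<And>y. y \<in> S \<Longrightarrow> (h has_derivative (\<lambda>v. b y \<bullet> v)) (at y)"
  shows "curl2 b x = 0"
proof -
  have "((\<lambda>y. blinfun_inner_right (b y)) has_derivative (\<lambda>v. blinfun_inner_right (b' v))) (at x)"
    by (rule bounded_linear.has_derivative[OF bounded_linear_blinfun_inner_right b'])
  then have sym: "blinfun_inner_right (b' u) v = blinfun_inner_right (b' v) u" for u v
    by (rule symmetric_second_derivative[where f = h, OF assms(1,2), rotated]) (simp add: h)
  have partial: "partial_deriv (\<lambda>y. b y $ i) j x = b' (axis j 1) $ i" for i j
    by (rule partial_deriv_eq) (rule bounded_linear.has_derivative[OF bounded_linear_vec_nth b'])
  show ?thesis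
    using sym[of "axis 1 1" "axis 2 1"] by (simp add: curl2_def partial inner_axis)
qed

section \<open>The phase-corrected optical path as a potential\<close>

theorem proposition3p1:
  fixes \<Omega> :: "(real^2) set"
    and a n\<^sub>1 n\<^sub>2 n\<^sub>3 \<kappa>\<^sub>1 \<kappa>\<^sub>2 k :: real
    and e P \<nu> m :: "real^2 \<Rightarrow> real^3"
    and \<rho> lam d :: "real^2 \<Rightarrow> real"
    and Q :: "real^2 \<Rightarrow> real^2"
    and \<sigma>\<^sub>1 \<sigma>\<^sub>2 M\<^sub>I M\<^sub>I\<^sub>I :: "(real^3) set"
  assumes "open \<Omega>" and "connected \<Omega>"
    and "0 < a"
    and "0 < n\<^sub>1" and "0 < n\<^sub>2" and "0 < n\<^sub>3" and "n\<^sub>1 < n\<^sub>2"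
    and "\<kappa>\<^sub>1 = n\<^sub>2 / n\<^sub>1" and "\<kappa>\<^sub>2 = n\<^sub>3 / n\<^sub>2"
    and "0 < k"
    and "C1_on e \<Omega>"
    and "\<And>x. x \<in> \<Omega> \<Longrightarrow> norm (e x) = 1"
    and "\<And>x. x \<in> \<Omega> \<Longrightarrow> 0 < e x $ 3"
    and "C2_surface \<sigma>\<^sub>1"
    and "\<sigma>\<^sub>1 \<subseteq> {p. 0 < p $ 3 \<and> p $ 3 < a}"
    and "separates \<sigma>\<^sub>1 M\<^sub>I M\<^sub>I\<^sub>I"
    and "lies_below M\<^sub>I \<sigma>\<^sub>1"
    and "lies_between M\<^sub>I\<^sub>I \<sigma>\<^sub>1 a"
    and "\<And>x. x \<in> \<Omega> \<Longrightarrow> strikes_at (at_height x 0) (e x) \<sigma>\<^sub>1 (\<rho> x)"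
    and "C1_on \<rho> \<Omega>"
    and "\<And>x. x \<in> \<Omega> \<Longrightarrow> P x = at_height x 0 + \<rho> x *\<^sub>R e x"
    and "\<And>x. x \<in> \<Omega> \<Longrightarrow> unit_normal_toward \<sigma>\<^sub>1 M\<^sub>I\<^sub>I (P x) (\<nu> x)"
    and "\<And>x. x \<in> \<Omega> \<Longrightarrow> 0 \<le> e x \<bullet> \<nu> x"
    and "\<And>x. x \<in> \<Omega> \<Longrightarrow> 0 < \<nu> x $ 3"
    and "\<And>x. x \<in> \<Omega> \<Longrightarrow> lam x = e x \<bullet> \<nu> x - sqrt (\<kappa>\<^sub>1\<^sup>2 - 1 + (e x \<bullet> \<nu> x)\<^sup>2)"
    and "\<And>x. x \<in> \<Omega> \<Longrightarrow> m x = (1 / \<kappa>\<^sub>1) *\<^sub>R (e x - lam x *\<^sub>R \<nu> x)"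
    and "\<And>x. x \<in> \<Omega> \<Longrightarrow> d x = (a - \<rho> x * e x $ 3) / m x $ 3"
    and "\<And>x. x \<in> \<Omega> \<Longrightarrow> at_height (Q x) a = P x + d x *\<^sub>R m x"
    and "\<sigma>\<^sub>2 = (\<lambda>x. at_height (Q x) a) ` \<Omega>"
    and "\<exists>\<phi> N. open N \<and> \<sigma>\<^sub>2 \<subseteq> N \<and> C1_on \<phi> N \<and>
           (\<forall>x\<in>\<Omega>. generalized_snell k \<kappa>\<^sub>2 \<phi> (at_height (Q x) a) (m x) e3)"
  shows "(\<exists>h. C2_on h \<Omega> \<and> (\<forall>x\<in>\<Omega>. horiz (e x) = grad h x)) \<and>
         (\<forall>x\<in>\<Omega>. curl2 (\<lambda>y. horiz (e y)) x = 0)"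
proof -
  note \<Omega> = assms(1) and n = assms(4,5,7) and \<kappa>\<^sub>1_def = assms(8) and k = assms(10) and C1_e = assms(11)
    and e = assms(12,13) and C2_\<sigma>\<^sub>1 = assms(14) and strikes = assms(19) and C1_\<rho> = assms(20)
    and P = assms(21) and normal = assms(22,24) and lam = assms(25) and m = assms(26)
    and d = assms(27) and Q = assms(28) and \<sigma>\<^sub>2 = assms(29)
  obtain \<phi> N where "\<sigma>\<^sub>2 \<subseteq> N" and "C1_on \<phi> N"
    and snell: "\<And>x. x \<in> \<Omega> \<Longrightarrow> generalized_snell k \<kappa>\<^sub>2 \<phi> (at_height (Q x) a) (m x) e3"
    using assms(30) by blast
  have \<kappa>: "1 < \<kappa>\<^sub>1" using n by (simp add: \<kappa>\<^sub>1_def)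
  have \<nu>: "norm (\<nu> x) = 1" if "x \<in> \<Omega>" for x
    using normal(1)[OF that] by (simp add: unit_normal_toward_def)
  have PS: "P x \<in> \<sigma>\<^sub>1" if "x \<in> \<Omega>" for x
    using strikes[OF that] P[OF that] by (simp add: strikes_at_def)
  have lam_neg: "lam x < 0" and m_unit: "norm (m x) = 1" if "x \<in> \<Omega>" for x
    using snell_refraction[OF e(1)[OF that] \<nu>[OF that] \<kappa>] by (simp_all only: m[OF that] lam[OF that])
  \<comment> \<open>Positivity permits the division by \<open>m x $ 3\<close> when \<open>d\<close>
    is differentiated.\<close>
  have m3: "0 < m x $ 3" if "x \<in> \<Omega>" for x
  proof -
    have "lam x * \<nu> x $ 3 < 0"
      using lam_neg[OF that] normal(2)[OF that] by (simp add: mult_neg_pos)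
    then show ?thesis
      using e(2)[OF that] \<kappa> by (simp add: m[OF that])
  qed
  define h where "h x = \<kappa>\<^sub>1 / k * \<phi> (at_height (Q x) a) - \<rho> x - \<kappa>\<^sub>1 * d x" for x
  have P_der: "(P has_derivative (\<lambda>v. at_height v 0 + (\<rho> x *\<^sub>R e' v + \<rho>' v *\<^sub>R e x))) (at x)"
    if "x \<in> \<Omega>" and "(e has_derivative e') (at x)" and "(\<rho> has_derivative \<rho>') (at x)" for x e' \<rho>'
  proof (rule has_derivative_transform_within_open[OF _ \<Omega> \<open>x \<in> \<Omega>\<close>])
    show "((\<lambda>x. at_height x 0 + \<rho> x *\<^sub>R e x) has_derivative
        (\<lambda>v. at_height v 0 + (\<rho> x *\<^sub>R e' v + \<rho>' v *\<^sub>R e x))) (at x)"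
      by (intro has_derivative_add has_derivative_scaleR that linear_imp_has_derivative linear_at_height)
    show "at_height y 0 + \<rho> y *\<^sub>R e y = P y" if "y \<in> \<Omega>" for y
      by (simp add: P[OF that])
  qed
  have contP: "continuous_on \<Omega> P"
  proof (intro continuous_at_imp_continuous_on ballI)
    fix x assume "x \<in> \<Omega>"
    then obtain e' \<rho>' where "(e has_derivative e') (at x)" "(\<rho> has_derivative \<rho>') (at x)"
      using C1_on_differentiable[OF C1_e] C1_on_differentiable[OF C1_\<rho>] unfolding differentiable_def by blast
    from P_der[OF \<open>x \<in> \<Omega>\<close> this] show "isCont P x"
      by (rule has_derivative_continuous)
  qed
  have h_der: "(h has_derivative (\<lambda>v. horiz (e x) \<bullet> v)) (at x)" if x: "x \<in> \<Omega>" for x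
  proof -
    obtain e' \<rho>' where e': "(e has_derivative e') (at x)" and \<rho>': "(\<rho> has_derivative \<rho>') (at x)"
      using C1_on_differentiable[OF C1_e x] C1_on_differentiable[OF C1_\<rho> x] unfolding differentiable_def by blast
    define P' where "P' v = at_height v 0 + (\<rho> x *\<^sub>R e' v + \<rho>' v *\<^sub>R e x)" for v
    have P': "(P has_derivative P') (at x)"
      unfolding P'_def[abs_def] by (rule P_der[OF x e' \<rho>'])
    note field = unit_normal_field[OF C2_\<sigma>\<^sub>1 \<Omega> x PS P' contP normal]
    have diff_e: "e differentiable (at x)" and diff_\<rho>: "\<rho> differentiable (at x)"
      using e' \<rho>' by (auto intro: differentiableI)
    \<comment> \<open>The radicand must stay away from 0, where the square root is not
      differentiable.\<close>
    have "1 < \<kappa>\<^sub>1\<^sup>2" using \<kappa> by (simp add: power2_eq_square less_1_mult)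
    then have rad: "0 < \<kappa>\<^sub>1\<^sup>2 - 1 + (e x \<bullet> \<nu> x)\<^sup>2" by (simp add: add_pos_nonneg)
    have sqrt: "sqrt differentiable (at (\<kappa>\<^sub>1\<^sup>2 - 1 + (e x \<bullet> \<nu> x)\<^sup>2))"
      using DERIV_real_sqrt[OF rad] unfolding has_field_derivative_def by (rule differentiableI)
    have "(\<lambda>y. e y \<bullet> \<nu> y) differentiable (at x)"
      by (intro differentiable_inner diff_e field(1))
    moreover from this have "(\<lambda>y. sqrt (\<kappa>\<^sub>1\<^sup>2 - 1 + (e y \<bullet> \<nu> y)\<^sup>2)) differentiable (at x)"
      by (intro differentiable_compose[where f = sqrt and
            g = "\<lambda>y. \<kappa>\<^sub>1\<^sup>2 - 1 + (e y \<bullet> \<nu> y)\<^sup>2", OF sqrt] differentiable_add differentiable_power differentiable_const)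
    ultimately have "(\<lambda>y. e y \<bullet> \<nu> y - sqrt (\<kappa>\<^sub>1\<^sup>2 - 1 + (e y \<bullet> \<nu> y)\<^sup>2)) differentiable (at x)"
      by (rule differentiable_diff)
    then have "lam differentiable (at x)"
      by (rule differentiable_transform_open[OF _ \<Omega> x]) (simp add: lam)
    then have "(\<lambda>y. (1 / \<kappa>\<^sub>1) *\<^sub>R (e y - lam y *\<^sub>R \<nu> y)) differentiable (at x)"
      by (intro differentiable_scaleR differentiable_diff differentiable_const diff_e field(1))
    then have diff_m: "m differentiable (at x)"
      by (rule differentiable_transform_open[OF _ \<Omega> x]) (simp add: m)
    then obtain m' where m': "(m has_derivative m') (at x)" unfolding differentiable_def by blast
    have "(\<lambda>y. f y $ 3) differentiable (at x)" if "f differentiable (at x)" for f :: "real^2 \<Rightarrow> real^3"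
      by (rule differentiable_compose[where f = "\<lambda>v. v $ 3", OF bounded_linear_imp_differentiable
          [OF bounded_linear_vec_nth] that])
    note component = this[OF diff_e] this[OF diff_m]
    have "(\<lambda>y. (a - \<rho> y * e y $ 3) / m y $ 3) differentiable (at x)"
      using m3[OF x] diff_\<rho>
      by (intro differentiable_divide differentiable_diff differentiable_mult differentiable_const component) auto
    then have "d differentiable (at x)"
      by (rule differentiable_transform_open[OF _ \<Omega> x]) (simp add: d)
    then obtain d' where d': "(d has_derivative d') (at x)" unfolding differentiable_def by blast
    define Q' where "Q' v = P' v + (d x *\<^sub>R m' v + d' v *\<^sub>R m x)" for v
    have Q': "((\<lambda>y. at_height (Q y) a) has_derivative Q') (at x)"
    proof (rule has_derivative_transform_within_open[OF _ \<Omega> x])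
      show "((\<lambda>y. P y + d y *\<^sub>R m y) has_derivative Q') (at x)"
        unfolding Q'_def[abs_def] by (intro has_derivative_add has_derivative_scaleR P' d' m')
    qed (simp add: Q)
    \<comment> \<open>\<open>Q'\<close> is assembled from \<open>P'\<close>, \<open>d'\<close> and
      \<open>m'\<close>; that it is horizontal follows by uniqueness of derivatives from the
      constant height \<open>a\<close>.\<close>
    have "((\<lambda>y. at_height (Q y) a $ 3) has_derivative (\<lambda>v. Q' v $ 3)) (at x)"
      by (rule bounded_linear.has_derivative[OF bounded_linear_vec_nth Q'])
    moreover have "((\<lambda>y. at_height (Q y) a $ 3) has_derivative (\<lambda>v. 0)) (at x)"
      by (simp add: at_height_def)
    ultimately have "(\<lambda>v. Q' v $ 3) = (\<lambda>v. 0)"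
      by (rule has_derivative_unique)
    then have Q'3: "Q' v $ 3 = 0" for v
      by (rule fun_cong)
    have "at_height (Q x) a \<in> N" using \<open>\<sigma>\<^sub>2 \<subseteq> N\<close> x by (auto simp: \<sigma>\<^sub>2)
    then obtain \<phi>' where \<phi>': "(\<phi> has_derivative \<phi>') (at (at_height (Q x) a))"
      using C1_on_differentiable[OF \<open>C1_on \<phi> N\<close>] unfolding differentiable_def by blast
    have "(h has_derivative (\<lambda>v. \<kappa>\<^sub>1 / k * \<phi>' (Q' v) - \<rho>' v - \<kappa>\<^sub>1 * d' v)) (at x)"
      unfolding h_def[abs_def]
      by (intro has_derivative_diff has_derivative_mult_right \<rho>' d' has_derivative_compose[OF Q' \<phi>'])
    moreover have "\<kappa>\<^sub>1 / k * \<phi>' (Q' v) - \<rho>' v - \<kappa>\<^sub>1 * d' v = horiz (e x) \<bullet> v" for v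
    proof -
      have "\<phi>' (Q' v) / k = m x \<bullet> Q' v"
        using generalized_snell_horizontal[OF snell[OF x] Q'3] by (simp add: grad_inner[OF \<phi>'])
      \<comment> \<open>In \<open>Q' v\<close> the term with \<open>m' v\<close> is orthogonal to
        the unit vector \<open>m x\<close>, and the term along \<open>m x\<close> contributes
        \<open>d' v\<close>.\<close>
      also have "\<dots> = P' v \<bullet> m x + d' v"
        using unit_field_orthogonal[OF m' \<Omega> x m_unit, of v] m_unit[OF x]
        by (simp add: Q'_def inner_add_right dot_square_norm inner_commute)
      finally have "\<kappa>\<^sub>1 / k * \<phi>' (Q' v) = P' v \<bullet> (\<kappa>\<^sub>1 *\<^sub>R m x) + \<kappa>\<^sub>1 * d' v"
        by (simp add: algebra_simps flip: times_divide_eq_right)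
      also have "P' v \<bullet> (\<kappa>\<^sub>1 *\<^sub>R m x) = P' v \<bullet> e x"
        using field(2)[of v] \<kappa> by (simp add: m[OF x] inner_diff_right)
      also have "\<dots> = horiz (e x) \<bullet> v + \<rho>' v"
        using unit_field_orthogonal[OF e' \<Omega> x e(1), of v] e(1)[OF x]
        by (simp add: P'_def inner_add_left inner_at_height dot_square_norm)
      finally show ?thesis by simp
    qed
    ultimately show ?thesis by simp
  qed
  have blin: "bounded_linear horiz"
    using linear_horiz by (rule linear_conv_bounded_linear[THEN iffD1])
  have C1_b: "C1_on (\<lambda>x. horiz (e x)) \<Omega>"
    by (rule C1_on_bounded_linear[OF blin C1_e])
  show ?thesis
  proof (intro conjI exI[of _ h] ballI)
    show "C2_on h \<Omega>"
      \<comment> \<open>The formula for \<open>h\<close>, with \<open>\<phi>\<close> only C1, does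
        not display a second derivative; C2 regularity comes from the gradient being the C1 field
        \<open>horiz (e x)\<close>.\<close>
      by (rule C2_onI_gradient[OF C1_b h_der])
  next
    fix x assume x: "x \<in> \<Omega>"
    show "horiz (e x) = grad h x"
      by (rule grad_eqI[OF h_der[OF x], symmetric])
    obtain b' where "((\<lambda>y. horiz (e y)) has_derivative b') (at x)"
      using C1_on_differentiable[OF C1_b x] unfolding differentiable_def by blast
    then show "curl2 (\<lambda>y. horiz (e y)) x = 0"
      by (rule curl2_gradient_field[OF \<Omega> x _ h_der])
  qed
qed

end
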